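(* Let $f\colon\mathbb{R}^n\to[-\infty,+\infty]$ be a proper nearly convex function and let $D\subset\mathbb{R}^n$ be a nonempty nearly convex set. Suppose that the regularity condition $(\mathrm{ri}\,D)\cap\mathrm{ri}(\mathrm{dom}\,f)\neq\emptyset$ is satisfied. Then the optimal value of the problem $\min\{f(x)\mid x\in D\}$ equals that of the associated convex problem $\min\{\bar f(x)\mid x\in\bar D\}$, i.e. $$\inf\{f(x)\mid x\in D\}=\inf\{\bar f(x)\mid x\in\bar D\}.$$
   Context: A set $\Omega\subset\mathbb{R}^n$ is nearly convex if there is a convex set $C\subset\mathbb{R}^n$ with $C\subset\Omega\subset\bar C$, where the bar on a set denotes topological closure. For an arbitrary set $\Omega$, $\mathrm{ri}\,\Omega$ is the interior of $\Omega$ relative to its affine hull. For $f\colon\mathbb{R}^n\to[-\infty,+\infty]$: $\mathrm{dom}\,f=\{x\mid f(x)<+\infty\}$, $\mathrm{epi}\,f=\{(x,\lambda)\in\mathbb{R}^n\times\mathbb{R}\mid f(x)\le\lambda\}$; $f$ is proper if $\mathrm{dom}\,f\ne\emptyset$ and $f(x)>-\infty$ for all $x$; $f$ is nearly convex if $\mathrm{epi}\,f$ is a nearly convex set. The function $\bar f\colon\mathbb{R}^n\to[-\infty,+\infty]$ is defined by $\bar f(x)=\inf\{\alpha\in\mathbb{R}\mid (x,\alpha)\in\overline{\mathrm{epi}\,f}\}$, with $\inf\emptyset=+\infty$. *)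

theory Defs
  imports "HOL-Analysis.Analysis"
begin

definition nearly_convex :: "'a::euclidean_space set \<Rightarrow> bool" where
  "nearly_convex S \<longleftrightarrow> (\<exists>C. convex C \<and> C \<subseteq> S \<and> S \<subseteq> closure C)"

definition edom :: "('a \<Rightarrow> ereal) \<Rightarrow> 'a set" where
  "edom f = {x. f x < \<infinity>}"

text \<open>The constant \<open>epigraph\<close> of HOL-Analysis is for real-valued functions only.\<close>

definition eepi :: "('a \<Rightarrow> ereal) \<Rightarrow> ('a \<times> real) set" where
  "eepi f = {(x, r). f x \<le> ereal r}"

definition proper_fun :: "('a \<Rightarrow> ereal) \<Rightarrow> bool" where
  "proper_fun f \<longleftrightarrow> edom f \<noteq> {} \<and> (\<forall>x. f x > - \<infinity>)"

definition nearly_convex_fun :: "('a::euclidean_space \<Rightarrow> ereal) \<Rightarrow> bool" where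
  "nearly_convex_fun f \<longleftrightarrow> nearly_convex (eepi f)"

text \<open>The infimum is taken in \<open>ereal\<close>, so it is \<open>\<infinity>\<close> for the empty set.\<close>

definition closure_fun :: "('a::euclidean_space \<Rightarrow> ereal) \<Rightarrow> 'a \<Rightarrow> ereal" where
  "closure_fun f x = Inf {ereal \<alpha> |\<alpha>. (x, \<alpha>) \<in> closure (eepi f)}"

end

theory Submission
  imports Defs
begin

text \<open>Let \<open>K\<close> and \<open>C\<close> be convex sets sandwiching the epigraph of \<open>f\<close> and \<open>D\<close>. A common relative
  interior point \<open>z\<close> of \<open>D\<close> and the domain of \<open>f\<close> lifts to a point \<open>(z, \<beta>)\<close> in the relative
  interior of \<open>K\<close>, since projections commute with relative interiors of convex sets. For
  \<open>x \<in> closure D\<close> and \<open>(x, \<alpha>)\<close> in the closed epigraph, the half-open segment from \<open>(z, \<beta>)\<close> to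
  \<open>(x, \<alpha>)\<close> stays in \<open>K\<close> and projects into \<open>C\<close>, so the infimum of \<open>f\<close> over \<open>D\<close> is bounded by the
  heights along this segment, which tend to \<open>\<alpha>\<close>.\<close>

text \<open>Passing from \<open>C\<close> to \<open>closure C\<close> changes neither the affine
  hull nor, by convexity, the relative interior, so \<open>S\<close> is squeezed between two sets
  for which both agree.\<close>

lemma rel_interior_sandwich:
  fixes C S :: "'a::euclidean_space set"
  assumes "convex C" "C \<subseteq> S" "S \<subseteq> closure C"
  shows "rel_interior S = rel_interior C"
proof -
  have "affine hull C \<subseteq> affine hull S"
    using assms(2) by (rule hull_mono)
  moreover have "affine hull S \<subseteq> affine hull C"
    using hull_mono[OF assms(3), of affine] by simp
  ultimately have hull: "affine hull S = affine hull C"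
    by blast
  have "rel_interior C \<subseteq> rel_interior S"
    using assms(2) hull by (intro subset_rel_interior) auto
  moreover have "rel_interior S \<subseteq> rel_interior (closure C)"
    using assms(3) hull by (intro subset_rel_interior) auto
  ultimately show ?thesis
    using convex_rel_interior_closure[OF assms(1)] by blast
qed

lemma closure_sandwich:
  assumes "C \<subseteq> S" "S \<subseteq> closure C"
  shows "closure S = closure C"
  using assms closure_mono closure_minimal[OF _ closed_closure] by blast

lemma edom_eq_fst_eepi: "edom f = fst ` eepi f"
proof (intro equalityI subsetI)
  fix x assume "x \<in> edom f"
  then obtain r where "f x \<le> ereal r"
    by (cases "f x") (auto simp: edom_def)
  then show "x \<in> fst ` eepi f"
    by (force simp: eepi_def)
qed (auto simp: edom_def eepi_def intro: le_less_trans)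

lemma closure_fun_le: "closure_fun f x \<le> f x"
\<comment> \<open>Epigraph heights are real, so the comparison runs over real upper bounds of
  \<open>f x\<close>; for \<open>f x = \<infinity>\<close> there are none.\<close>
proof (rule ereal_le_real)
  fix r assume "f x \<le> ereal r"
  then have "(x, r) \<in> closure (eepi f)"
    using closure_subset by (force simp: eepi_def)
  then show "closure_fun f x \<le> ereal r"
    unfolding closure_fun_def by (intro Inf_lower) auto
qed

lemma INF_le_closure_epigraph:
  fixes f :: "'a::euclidean_space \<Rightarrow> ereal"
  assumes f: "nearly_convex_fun f" and D: "nearly_convex D"
    and ri: "rel_interior D \<inter> rel_interior (edom f) \<noteq> {}"
    and x: "x \<in> closure D" and epi: "(x, \<alpha>) \<in> closure (eepi f)"
  shows "(INF y\<in>D. f y) \<le> ereal \<alpha>"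
proof -
  obtain K where K: "convex K" "K \<subseteq> eepi f" "eepi f \<subseteq> closure K"
    using f unfolding nearly_convex_fun_def nearly_convex_def by blast
  obtain C where C: "convex C" "C \<subseteq> D" "D \<subseteq> closure C"
    using D unfolding nearly_convex_def by blast
  \<comment> \<open>The domain inherits near convexity from the epigraph, with the shadow of
    \<open>K\<close> as convex core; this is what allows \<open>z\<close> to be lifted into
    \<open>K\<close>.\<close>
  have "rel_interior (edom f) = rel_interior (fst ` K)"
  proof (rule rel_interior_sandwich)
    show "convex (fst ` K)"
      using K(1) by (intro convex_linear_image linear_fst)
    show "fst ` K \<subseteq> edom f"
      using K(2) by (auto simp: edom_eq_fst_eepi)
    have "fst ` closure K \<subseteq> closure (fst ` K)"
      by (intro image_closure_subset closed_closure closure_subset continuous_intros)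
    then show "edom f \<subseteq> closure (fst ` K)"
      using K(3) by (auto simp: edom_eq_fst_eepi)
  qed
  also have "\<dots> = fst ` rel_interior K"
    using rel_interior_convex_linear_image[OF linear_fst K(1)] by simp
  finally obtain z \<beta> where zK: "(z, \<beta>) \<in> rel_interior K" and zD: "z \<in> rel_interior D"
    using ri by auto
  have zC: "z \<in> rel_interior C"
    using zD rel_interior_sandwich[OF C] by simp
  have xC: "x \<in> closure C" and xK: "(x, \<alpha>) \<in> closure K"
    using x epi closure_sandwich[OF C(2,3)] closure_sandwich[OF K(2,3)] by auto
  \<comment> \<open>The value \<open>e = 0\<close> is excluded: it gives
    \<open>(x, \<alpha>)\<close> itself, known only to lie in the closures.\<close>
  have le: "(INF y\<in>D. f y) \<le> ereal (\<alpha> - e * (\<alpha> - \<beta>))" if e: "0 < e" "e \<le> 1" for e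
  proof -
    have "x - e *\<^sub>R (x - z) \<in> rel_interior C"
      by (rule rel_interior_closure_convex_shrink[OF C(1) zC xC e])
    then have "x - e *\<^sub>R (x - z) \<in> D"
      using C(2) rel_interior_subset by blast
    moreover have "(x, \<alpha>) - e *\<^sub>R ((x, \<alpha>) - (z, \<beta>)) \<in> rel_interior K"
      by (rule rel_interior_closure_convex_shrink[OF K(1) zK xK e])
    then have "(x, \<alpha>) - e *\<^sub>R ((x, \<alpha>) - (z, \<beta>)) \<in> eepi f"
      using K(2) rel_interior_subset by blast
    then have "f (x - e *\<^sub>R (x - z)) \<le> ereal (\<alpha> - e * (\<alpha> - \<beta>))"
      by (simp add: eepi_def)
    ultimately show ?thesis
      by (rule INF_lower2)
  qed
  have "((\<lambda>e. \<alpha> - e * (\<alpha> - \<beta>)) \<longlongrightarrow> \<alpha> - 0 * (\<alpha> - \<beta>)) (at_right 0)"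
    by (intro tendsto_intros)
  then have "((\<lambda>e. ereal (\<alpha> - e * (\<alpha> - \<beta>))) \<longlongrightarrow> ereal \<alpha>) (at_right 0)"
    by simp
  moreover have "\<forall>\<^sub>F e in at_right 0. (INF y\<in>D. f y) \<le> ereal (\<alpha> - e * (\<alpha> - \<beta>))"
    by (rule eventually_mono[OF eventually_at_right_real[of 0 1]]) (auto intro: le)
  ultimately show ?thesis
    by (rule tendsto_lowerbound) simp
qed

theorem theorem3p1:
  fixes f :: "real ^ 'n \<Rightarrow> ereal" and D :: "(real ^ 'n) set"
  assumes "proper_fun f"
    and "nearly_convex_fun f"
    and "D \<noteq> {}"
    and "nearly_convex D"
    and "rel_interior D \<inter> rel_interior (edom f) \<noteq> {}"
  shows "(INF x\<in>D. f x) = (INF x\<in>closure D. closure_fun f x)"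
proof (rule antisym)
  show "(INF x\<in>D. f x) \<le> (INF x\<in>closure D. closure_fun f x)"
  proof (rule INF_greatest)
    fix x assume "x \<in> closure D"
    \<comment> \<open>Each height \<alpha> over \<open>x\<close> is bounded separately, so the
      infimum need not be attained; with no such height it is \<infinity>.\<close>
    then show "(INF x\<in>D. f x) \<le> closure_fun f x"
      unfolding closure_fun_def
      using INF_le_closure_epigraph[OF assms(2,4,5)] by (intro Inf_greatest) auto
  qed
  show "(INF x\<in>closure D. closure_fun f x) \<le> (INF x\<in>D. f x)"
    using closure_subset closure_fun_le by (intro INF_mono) blast
qed

end
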